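(* Let $(\Sigma',\mathcal H')$ be the quasi-equational theory described in the context. There is an equivalence of categories $$\mathrm{Alg}(\Sigma',\mathcal H')\simeq \mathbf{POGrp}$$ between the category of models of $(\Sigma',\mathcal H')$ in sets (with maps preserving all operations as morphisms) and the category of preordered groups.
   Context: Groups are written additively and need not be abelian. A preordered group is a group $G$ with a preorder compatible with addition on both sides; equivalently, a pair $(G,P_G)$ where $G$ is a group and $P_G$ is a submonoid of $G$ (the positive cone) stable under conjugation by every element of $G$. The category $\mathbf{POGrp}$ has these as objects, and as morphisms $(G,P_G)\to(H,P_H)$ the group homomorphisms $f:G\to H$ with $f(P_G)\subseteq P_H$. The signature $\Sigma'$ has one constant $0$, five unary operations $\iota,\pi_0,\pi_1,-,\rhd$ and one binary operation $+$. Write $a_i$ for $\pi_i(a)$ ($i=0,1$) and $a-b$ for $a+(-b)$. The axioms $\mathcal H'$ (all variables universally quantified) are: (M) $(0,+)$ satisfies the axioms of monoids, and each $f\in\{\pi_0,\pi_1,\iota\}$ satisfies $f(a)+f(b)=f(a+b)$ and $f(0)=0$; (P1) $a=a_0+a_1=a_1+a_0$; (P2) $-(a_1)=0$, $(\iota(a))_1=0$, $(a_1)_0=0$, $(a_0)_1=0$; (P3) $\iota(a_1)=(\iota(a))_0$; (G) $a-a=-a+a=a_1$ (that is, $a+(-a)=(-a)+a=a_1$); (Inj) $\iota(a)=\iota(b)\Rightarrow a_1=b_1$; (C1) $\iota(\rhd(a))=a_0+\iota(a_1)-a_0$; (C2) $(\rhd(a))_0=0$. *)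

theory Defs
  imports "HOL-Algebra.Group"
begin

section \<open>Categories and equivalences\<close>

text \<open>
  A category is given by a family of hom-sets which need not be pairwise disjoint; hence
  composition and the action of a functor on morphisms take the objects as arguments.
  \<open>Comp C a b c g f\<close> is the composite of \<open>f\<close> in \<open>Hom C a b\<close> with \<open>g\<close> in \<open>Hom C b c\<close>.
\<close>

record ('o, 'm) cat =
  Obj :: "'o set"
  Hom :: "'o \<Rightarrow> 'o \<Rightarrow> 'm set"
  Ident :: "'o \<Rightarrow> 'm"
  Comp :: "'o \<Rightarrow> 'o \<Rightarrow> 'o \<Rightarrow> 'm \<Rightarrow> 'm \<Rightarrow> 'm"

locale category =
  fixes C :: "('o, 'm) cat"
  assumes Ident_in_Hom: "a \<in> Obj C \<Longrightarrow> Ident C a \<in> Hom C a a"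
    and Comp_in_Hom:
      "\<lbrakk>a \<in> Obj C; b \<in> Obj C; c \<in> Obj C; f \<in> Hom C a b; g \<in> Hom C b c\<rbrakk>
        \<Longrightarrow> Comp C a b c g f \<in> Hom C a c"
    and Comp_Ident_right:
      "\<lbrakk>a \<in> Obj C; b \<in> Obj C; f \<in> Hom C a b\<rbrakk> \<Longrightarrow> Comp C a a b f (Ident C a) = f"
    and Comp_Ident_left:
      "\<lbrakk>a \<in> Obj C; b \<in> Obj C; f \<in> Hom C a b\<rbrakk> \<Longrightarrow> Comp C a b b (Ident C b) f = f"
    and Comp_assoc:
      "\<lbrakk>a \<in> Obj C; b \<in> Obj C; c \<in> Obj C; d \<in> Obj C;
        f \<in> Hom C a b; g \<in> Hom C b c; h \<in> Hom C c d\<rbrakk>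
        \<Longrightarrow> Comp C a b d (Comp C b c d h g) f = Comp C a c d h (Comp C a b c g f)"

record ('o, 'm, 'p, 'n) fctr =
  Fobj :: "'o \<Rightarrow> 'p"
  Fmap :: "'o \<Rightarrow> 'o \<Rightarrow> 'm \<Rightarrow> 'n"

locale cat_functor = C: category C + D: category D
  for C :: "('o, 'm) cat" and D :: "('p, 'n) cat" +
  fixes F :: "('o, 'm, 'p, 'n) fctr"
  assumes Fobj_in_Obj: "a \<in> Obj C \<Longrightarrow> Fobj F a \<in> Obj D"
    and Fmap_in_Hom:
      "\<lbrakk>a \<in> Obj C; b \<in> Obj C; f \<in> Hom C a b\<rbrakk>
        \<Longrightarrow> Fmap F a b f \<in> Hom D (Fobj F a) (Fobj F b)"
    and Fmap_Ident: "a \<in> Obj C \<Longrightarrow> Fmap F a a (Ident C a) = Ident D (Fobj F a)"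
    and Fmap_Comp:
      "\<lbrakk>a \<in> Obj C; b \<in> Obj C; c \<in> Obj C; f \<in> Hom C a b; g \<in> Hom C b c\<rbrakk>
        \<Longrightarrow> Fmap F a c (Comp C a b c g f) =
            Comp D (Fobj F a) (Fobj F b) (Fobj F c) (Fmap F b c g) (Fmap F a b f)"

definition id_fctr :: "('o, 'm, 'o, 'm) fctr" where
  "id_fctr = \<lparr>Fobj = (\<lambda>a. a), Fmap = (\<lambda>a b f. f)\<rparr>"

definition comp_fctr ::
  "('p, 'n, 'q, 'k) fctr \<Rightarrow> ('o, 'm, 'p, 'n) fctr \<Rightarrow> ('o, 'm, 'q, 'k) fctr" where
  "comp_fctr G F =
    \<lparr>Fobj = (\<lambda>a. Fobj G (Fobj F a)),
     Fmap = (\<lambda>a b f. Fmap G (Fobj F a) (Fobj F b) (Fmap F a b f))\<rparr>"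

definition is_iso :: "('o, 'm) cat \<Rightarrow> 'o \<Rightarrow> 'o \<Rightarrow> 'm \<Rightarrow> bool" where
  "is_iso C a b f \<longleftrightarrow>
    f \<in> Hom C a b \<and>
    (\<exists>g \<in> Hom C b a. Comp C a b a g f = Ident C a \<and> Comp C b a b f g = Ident C b)"

definition natural_iso ::
  "('o, 'm) cat \<Rightarrow> ('p, 'n) cat \<Rightarrow> ('o, 'm, 'p, 'n) fctr \<Rightarrow> ('o, 'm, 'p, 'n) fctr
    \<Rightarrow> ('o \<Rightarrow> 'n) \<Rightarrow> bool" where
  "natural_iso C D F G \<eta> \<longleftrightarrow>
    (\<forall>a \<in> Obj C. is_iso D (Fobj F a) (Fobj G a) (\<eta> a)) \<and>
    (\<forall>a \<in> Obj C. \<forall>b \<in> Obj C. \<forall>f \<in> Hom C a b.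
      Comp D (Fobj F a) (Fobj F b) (Fobj G b) (\<eta> b) (Fmap F a b f) =
      Comp D (Fobj F a) (Fobj G a) (Fobj G b) (Fmap G a b f) (\<eta> a))"

definition equivalent_categories :: "('o, 'm) cat \<Rightarrow> ('p, 'n) cat \<Rightarrow> bool" where
  "equivalent_categories C D \<longleftrightarrow>
    category C \<and> category D \<and>
    (\<exists>F G. cat_functor C D F \<and> cat_functor D C G \<and>
      (\<exists>\<eta>. natural_iso C C id_fctr (comp_fctr G F) \<eta>) \<and>
      (\<exists>\<epsilon>. natural_iso D D (comp_fctr F G) id_fctr \<epsilon>))"

section \<open>Quasi-equational theories and their categories of models\<close>

text \<open>
  A signature is a type \<open>'f\<close> of operation symbols together with an arity function.
\<close>

datatype 'f trm = Var nat | App 'f "'f trm list"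

datatype 'f quasi_eq =
  Quasi_Eq (prems: "('f trm \<times> 'f trm) list") (concl: "'f trm \<times> 'f trm")

record ('u, 'f) alg_struct = "'u partial_object" +
  interp :: "'f \<Rightarrow> 'u list \<Rightarrow> 'u"

primrec trm_val :: "('u, 'f) alg_struct \<Rightarrow> (nat \<Rightarrow> 'u) \<Rightarrow> 'f trm \<Rightarrow> 'u" where
  "trm_val M v (Var i) = v i"
| "trm_val M v (App f ts) = interp M f (map (trm_val M v) ts)"

definition holds :: "('u, 'f) alg_struct \<Rightarrow> (nat \<Rightarrow> 'u) \<Rightarrow> 'f trm \<times> 'f trm \<Rightarrow> bool" where
  "holds M v e \<longleftrightarrow> trm_val M v (fst e) = trm_val M v (snd e)"

definition satisfies :: "('u, 'f) alg_struct \<Rightarrow> 'f quasi_eq \<Rightarrow> bool" where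
  "satisfies M q \<longleftrightarrow>
    (\<forall>v. range v \<subseteq> carrier M \<longrightarrow>
      (\<forall>e \<in> set (prems q). holds M v e) \<longrightarrow> holds M v (concl q))"

definition is_model :: "('f \<Rightarrow> nat) \<Rightarrow> 'f quasi_eq set \<Rightarrow> ('u, 'f) alg_struct \<Rightarrow> bool" where
  "is_model ar H M \<longleftrightarrow>
    (\<forall>f xs. length xs = ar f \<and> set xs \<subseteq> carrier M \<longrightarrow> interp M f xs \<in> carrier M) \<and>
    (\<forall>q \<in> H. satisfies M q)"

text \<open>
  Maps between carriers are extensional functions, so that equality of morphisms is equality
  on the carrier of the domain.  The type \<open>'u\<close> plays the role of the universe of sets: all subsets
  of it are allowed as carriers.  It has to be infinite for this universe to be closed, up to
  bijection, under binary products.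
\<close>

definition model_hom ::
  "('f \<Rightarrow> nat) \<Rightarrow> ('u, 'f) alg_struct \<Rightarrow> ('u, 'f) alg_struct \<Rightarrow> ('u \<Rightarrow> 'u) set" where
  "model_hom ar M N =
    {h \<in> carrier M \<rightarrow>\<^sub>E carrier N.
      \<forall>f xs. length xs = ar f \<and> set xs \<subseteq> carrier M \<longrightarrow>
        h (interp M f xs) = interp N f (map h xs)}"

definition Alg ::
  "('f \<Rightarrow> nat) \<Rightarrow> 'f quasi_eq set \<Rightarrow> (('u, 'f) alg_struct, 'u \<Rightarrow> 'u) cat" where
  "Alg ar H =
    \<lparr>Obj = {M. is_model ar H M},
     Hom = model_hom ar,
     Ident = (\<lambda>M. \<lambda>x \<in> carrier M. x),
     Comp = (\<lambda>M N K g f. compose (carrier M) g f)\<rparr>"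

section \<open>The theory with signature \<open>\<Sigma>'\<close> and axioms \<open>\<H>'\<close>\<close>

datatype sym = Zero | Iota | Pi0 | Pi1 | Neg | Rhd | Plus

fun sym_arity :: "sym \<Rightarrow> nat" where
  "sym_arity Zero = 0"
| "sym_arity Plus = 2"
| "sym_arity _ = 1"

context
begin

private abbreviation (input) "a \<equiv> Var 0"
private abbreviation (input) "b \<equiv> Var 1"
private abbreviation (input) "c \<equiv> Var 2"
private abbreviation (input) zero ("\<O>") where "\<O> \<equiv> App Zero []"
private abbreviation (input) plus (infixl "\<boxplus>" 65) where "s \<boxplus> t \<equiv> App Plus [s, t]"
private abbreviation (input) "neg t \<equiv> App Neg [t]"
private abbreviation (input) minus (infixl "\<boxminus>" 65) where "s \<boxminus> t \<equiv> s \<boxplus> neg t"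
private abbreviation (input) "\<iota> t \<equiv> App Iota [t]"
private abbreviation (input) "\<pi>0 t \<equiv> App Pi0 [t]"
private abbreviation (input) "\<pi>1 t \<equiv> App Pi1 [t]"
private abbreviation (input) "rhd t \<equiv> App Rhd [t]"
private abbreviation (input) equation (infix "\<doteq>" 50) where "s \<doteq> t \<equiv> Quasi_Eq [] (s, t)"

definition axioms_M :: "sym quasi_eq set" where
  "axioms_M =
    {(a \<boxplus> b) \<boxplus> c \<doteq> a \<boxplus> (b \<boxplus> c), \<O> \<boxplus> a \<doteq> a, a \<boxplus> \<O> \<doteq> a,
     \<pi>0 a \<boxplus> \<pi>0 b \<doteq> \<pi>0 (a \<boxplus> b), \<pi>0 \<O> \<doteq> \<O>,
     \<pi>1 a \<boxplus> \<pi>1 b \<doteq> \<pi>1 (a \<boxplus> b), \<pi>1 \<O> \<doteq> \<O>,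
     \<iota> a \<boxplus> \<iota> b \<doteq> \<iota> (a \<boxplus> b), \<iota> \<O> \<doteq> \<O>}"

definition axioms_P :: "sym quasi_eq set" where
  "axioms_P =
    {a \<doteq> \<pi>0 a \<boxplus> \<pi>1 a, a \<doteq> \<pi>1 a \<boxplus> \<pi>0 a,
     neg (\<pi>1 a) \<doteq> \<O>, \<pi>1 (\<iota> a) \<doteq> \<O>, \<pi>0 (\<pi>1 a) \<doteq> \<O>, \<pi>1 (\<pi>0 a) \<doteq> \<O>,
     \<iota> (\<pi>1 a) \<doteq> \<pi>0 (\<iota> a)}"

definition axioms_G :: "sym quasi_eq set" where
  "axioms_G = {a \<boxminus> a \<doteq> \<pi>1 a, neg a \<boxplus> a \<doteq> \<pi>1 a}"

definition axioms_Inj :: "sym quasi_eq set" where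
  "axioms_Inj = {Quasi_Eq [(\<iota> a, \<iota> b)] (\<pi>1 a, \<pi>1 b)}"

definition axioms_C :: "sym quasi_eq set" where
  "axioms_C = {\<iota> (rhd a) \<doteq> (\<pi>0 a \<boxplus> \<iota> (\<pi>1 a)) \<boxminus> \<pi>0 a, \<pi>0 (rhd a) \<doteq> \<O>}"

end

definition axioms_POGrp :: "sym quasi_eq set" where
  "axioms_POGrp = axioms_M \<union> axioms_P \<union> axioms_G \<union> axioms_Inj \<union> axioms_C"

section \<open>The category of preordered groups\<close>

text \<open>
  The (not necessarily abelian) group operation is written multiplicatively, as in the
  library's group records.
\<close>

record 'u preord_group = "'u monoid" +
  cone :: "'u set"

locale preordered_group = group G + submonoid "cone G" G
  for G :: "'u preord_group" (structure) +
  assumes conj_closed: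
    "\<lbrakk>g \<in> carrier G; p \<in> cone G\<rbrakk> \<Longrightarrow> g \<otimes> p \<otimes> inv g \<in> cone G"

definition POGrp :: "('u preord_group, 'u \<Rightarrow> 'u) cat" where
  "POGrp =
    \<lparr>Obj = {G. preordered_group G},
     Hom = (\<lambda>G H. {f \<in> hom G H \<inter> extensional (carrier G). f ` cone G \<subseteq> cone H}),
     Ident = (\<lambda>G. \<lambda>x \<in> carrier G. x),
     Comp = (\<lambda>G H K g f. compose (carrier G) g f)\<rparr>"

end

theory Submission
  imports Defs
begin

text \<open>
  In a model every element splits as \<open>a = a\<^sub>0 + a\<^sub>1\<close>.  The elements with \<open>a\<^sub>1 = 0\<close> form a group,
  into which \<open>\<iota>\<close> embeds the monoid of the \<open>a\<^sub>1\<close>; by (C1) its image is stable under conjugation.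
  Conversely, \<open>(G, P)\<close> yields the model \<open>G \<times> P\<close>, where \<open>\<iota>(g, p) = (p, 0)\<close>,
  \<open>-(g, p) = (-g, 0)\<close> and \<open>\<rhd>(g, p) = (0, g + p - g)\<close>.  The unit of the equivalence is
  \<open>a \<mapsto> (a\<^sub>0, \<iota>(a))\<close>.
\<close>

section \<open>The two categories\<close>

text \<open>Composites and identities are functions restricted to the carrier; closure of the
  carrier under the operations lets them be evaluated at \<open>interp a s xs\<close>.\<close>

lemma category_Alg: "category (Alg ar H)"
proof
  fix a b c f g
  assume "a \<in> Obj (Alg ar H)" "b \<in> Obj (Alg ar H)" "c \<in> Obj (Alg ar H)"
    and f: "f \<in> Hom (Alg ar H) a b" and g: "g \<in> Hom (Alg ar H) b c"
  then have cl: "\<And>s xs. length xs = ar s \<Longrightarrow> set xs \<subseteq> carrier a \<Longrightarrow> interp a s xs \<in> carrier a"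
    by (auto simp: Alg_def is_model_def)
  have fc: "f x \<in> carrier b" if "x \<in> carrier a" for x
    using f that by (auto simp: Alg_def model_hom_def)
  have "map (compose (carrier a) g f) xs = map g (map f xs)" if "set xs \<subseteq> carrier a" for xs
    using that by (auto simp: compose_def)
  moreover have "set (map f xs) \<subseteq> carrier b" if "set xs \<subseteq> carrier a" for xs
    using that fc by auto
  ultimately show "Comp (Alg ar H) a b c g f \<in> Hom (Alg ar H) a c"
    using f g cl fc
    by (auto simp: Alg_def model_hom_def compose_eq PiE_iff simp del: map_map set_map)
next
  fix a assume "a \<in> Obj (Alg ar H)"
  moreover have "map (\<lambda>x\<in>carrier a. x) xs = xs" if "set xs \<subseteq> carrier a" for xs
    using that by (auto intro!: map_idI)
  ultimately show "Ident (Alg ar H) a \<in> Hom (Alg ar H) a a"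
    by (auto simp: Alg_def model_hom_def is_model_def)
qed (auto simp: Alg_def model_hom_def compose_def fun_eq_iff PiE_def extensional_def Pi_def)

text \<open>The cone lies in the carrier, so restricting a composite or an identity to the carrier
  does not change its values on the cone.\<close>

lemma category_POGrp: "category POGrp"
proof
  fix a b c :: "'a preord_group" and f g
  assume a: "a \<in> Obj POGrp"
    and f: "f \<in> Hom POGrp a b" and g: "g \<in> Hom POGrp b c"
  interpret preordered_group a
    using a by (simp add: POGrp_def)
  show "Comp POGrp a b c g f \<in> Hom POGrp a c"
    using f g subset
    by (auto simp: POGrp_def hom_def compose_def Pi_iff image_subset_iff subset_iff)
next
  fix a :: "'a preord_group"
  assume a: "a \<in> Obj POGrp"
  interpret preordered_group a
    using a by (simp add: POGrp_def)
  show "Ident POGrp a \<in> Hom POGrp a a"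
    using subset by (auto simp: POGrp_def hom_def)
qed (auto simp: POGrp_def hom_def compose_def fun_eq_iff extensional_def Pi_def)

text \<open>Structures carry operations but no relations, so the inverse of a bijective morphism
  preserves everything: \<open>h\<close> maps \<open>interp M f (map ?g ys)\<close> to
  \<open>interp N f ys\<close>, and applying \<open>?g\<close> undoes \<open>h\<close>.\<close>

lemma is_iso_Alg:
  assumes M: "M \<in> Obj (Alg ar H)" and h: "h \<in> Hom (Alg ar H) M N"
    and bij: "bij_betw h (carrier M) (carrier N)"
  shows "is_iso (Alg ar H) M N h"
proof -
  let ?g = "\<lambda>y\<in>carrier N. inv_into (carrier M) h y"
  have gc: "?g y \<in> carrier M" "h (?g y) = y" if "y \<in> carrier N" for y
    using that bij by (auto simp: bij_betw_def inv_into_into f_inv_into_f)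
  have "?g (interp N f ys) = interp M f (map ?g ys)"
    if ys: "length ys = ar f" "set ys \<subseteq> carrier N" for f ys
  proof -
    have map_g: "set (map ?g ys) \<subseteq> carrier M" and "map h (map ?g ys) = ys"
      using ys(2) gc by (auto simp: subset_iff intro!: map_idI)
    moreover have x: "interp M f (map ?g ys) \<in> carrier M"
      using M map_g ys(1) by (simp add: Alg_def is_model_def del: set_map)
    ultimately have "h (interp M f (map ?g ys)) = interp N f ys"
      using h ys(1) by (simp add: Alg_def model_hom_def del: map_map set_map)
    then show ?thesis
      using x bij by (metis bij_betwE bij_betw_inv_into_left restrict_apply')
  qed
  then have "?g \<in> Hom (Alg ar H) N M"
    using gc by (auto simp: Alg_def model_hom_def)
  moreover have "h ` carrier M = carrier N"
    using bij by (simp add: bij_betw_def)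
  ultimately show ?thesis
    using h bij unfolding is_iso_def
    by (auto simp: Alg_def compose_inv_into_id compose_id_inv_into intro!: bexI[of _ ?g])
qed

text \<open>Here bijectivity alone is too weak: the identity from the integers with cone {0} to the
  integers with the usual cone is a bijective morphism without inverse. Mapping the cone onto the
  cone makes the inverse map monotone.\<close>

lemma is_iso_POGrp:
  assumes G: "G \<in> Obj POGrp" and H: "H \<in> Obj POGrp" and f: "f \<in> Hom POGrp G H"
    and bij: "bij_betw f (carrier G) (carrier H)" and cone: "f ` cone G = cone H"
  shows "is_iso POGrp G H f"
proof -
  interpret G: preordered_group G using G by (simp add: POGrp_def)
  interpret H: preordered_group H using H by (simp add: POGrp_def)
  let ?g = "\<lambda>y\<in>carrier H. inv_into (carrier G) f y"
  have "inv_into (carrier G) f \<in> iso H G"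
    using f bij by (intro G.iso_set_sym) (auto simp: POGrp_def iso_def)
  then have "?g \<in> hom H G"
    by (auto simp: iso_def hom_def Pi_iff)
  moreover have "?g ` cone H \<subseteq> cone G"
    using bij G.subset H.subset
    by (auto simp: cone[symmetric] bij_betw_def inv_into_f_f subset_iff)
  ultimately have "?g \<in> Hom POGrp H G"
    by (simp add: POGrp_def)
  moreover have "f ` carrier G = carrier H"
    using bij by (simp add: bij_betw_def)
  ultimately show ?thesis
    using f bij unfolding is_iso_def
    by (intro conjI bexI[of _ ?g]) (simp_all add: POGrp_def compose_inv_into_id compose_id_inv_into)
qed

section \<open>Models, unfolded\<close>

text \<open>A base without assumptions, so that its notation is available when the assumptions of
  \<open>pog_model\<close> are stated.\<close>

locale sym_struct =
  fixes M :: "('u, sym) alg_struct"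
begin

abbreviation "zero \<equiv> interp M Zero []"
abbreviation "iota x \<equiv> interp M Iota [x]"
abbreviation "pi0 x \<equiv> interp M Pi0 [x]"
abbreviation "pi1 x \<equiv> interp M Pi1 [x]"
abbreviation "neg x \<equiv> interp M Neg [x]"
abbreviation "rhd x \<equiv> interp M Rhd [x]"
abbreviation plus (infixl "\<oplus>" 65) where "x \<oplus> y \<equiv> interp M Plus [x, y]"

end

text \<open>The assumptions keep the literal shape and orientation of the axioms, since
  \<open>is_model_iff\<close> finishes by matching conjuncts.\<close>

locale pog_model = sym_struct +
  assumes zero_closed [simp]: "zero \<in> carrier M"
    and plus_closed [simp]: "\<lbrakk>x \<in> carrier M; y \<in> carrier M\<rbrakk> \<Longrightarrow> x \<oplus> y \<in> carrier M"
    and iota_closed [simp]: "x \<in> carrier M \<Longrightarrow> iota x \<in> carrier M"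
    and pi0_closed [simp]: "x \<in> carrier M \<Longrightarrow> pi0 x \<in> carrier M"
    and pi1_closed [simp]: "x \<in> carrier M \<Longrightarrow> pi1 x \<in> carrier M"
    and neg_closed [simp]: "x \<in> carrier M \<Longrightarrow> neg x \<in> carrier M"
    and rhd_closed [simp]: "x \<in> carrier M \<Longrightarrow> rhd x \<in> carrier M"
    and plus_assoc:
      "\<lbrakk>x \<in> carrier M; y \<in> carrier M; z \<in> carrier M\<rbrakk> \<Longrightarrow> x \<oplus> y \<oplus> z = x \<oplus> (y \<oplus> z)"
    and zero_plus [simp]: "x \<in> carrier M \<Longrightarrow> zero \<oplus> x = x"
    and plus_zero [simp]: "x \<in> carrier M \<Longrightarrow> x \<oplus> zero = x"
    and pi0_plus: "\<lbrakk>x \<in> carrier M; y \<in> carrier M\<rbrakk> \<Longrightarrow> pi0 x \<oplus> pi0 y = pi0 (x \<oplus> y)"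
    and pi0_zero [simp]: "pi0 zero = zero"
    and pi1_plus: "\<lbrakk>x \<in> carrier M; y \<in> carrier M\<rbrakk> \<Longrightarrow> pi1 x \<oplus> pi1 y = pi1 (x \<oplus> y)"
    and pi1_zero [simp]: "pi1 zero = zero"
    and iota_plus: "\<lbrakk>x \<in> carrier M; y \<in> carrier M\<rbrakk> \<Longrightarrow> iota x \<oplus> iota y = iota (x \<oplus> y)"
    and iota_zero [simp]: "iota zero = zero"
    and split01: "x \<in> carrier M \<Longrightarrow> x = pi0 x \<oplus> pi1 x"
    and split10: "x \<in> carrier M \<Longrightarrow> x = pi1 x \<oplus> pi0 x"
    and neg_pi1 [simp]: "x \<in> carrier M \<Longrightarrow> neg (pi1 x) = zero"
    and pi1_iota [simp]: "x \<in> carrier M \<Longrightarrow> pi1 (iota x) = zero"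
    and pi0_pi1 [simp]: "x \<in> carrier M \<Longrightarrow> pi0 (pi1 x) = zero"
    and pi1_pi0 [simp]: "x \<in> carrier M \<Longrightarrow> pi1 (pi0 x) = zero"
    and iota_pi1: "x \<in> carrier M \<Longrightarrow> iota (pi1 x) = pi0 (iota x)"
    and plus_neg: "x \<in> carrier M \<Longrightarrow> x \<oplus> neg x = pi1 x"
    and neg_plus: "x \<in> carrier M \<Longrightarrow> neg x \<oplus> x = pi1 x"
    and iota_inj:
      "\<lbrakk>x \<in> carrier M; y \<in> carrier M; iota x = iota y\<rbrakk> \<Longrightarrow> pi1 x = pi1 y"
    and iota_rhd: "x \<in> carrier M \<Longrightarrow> iota (rhd x) = pi0 x \<oplus> iota (pi1 x) \<oplus> neg (pi0 x)"
    and pi0_rhd [simp]: "x \<in> carrier M \<Longrightarrow> pi0 (rhd x) = zero"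

section \<open>Quantifiers over symbols, argument lists and valuations\<close>

lemma all_sym:
  "(\<forall>f. P f) \<longleftrightarrow> P Zero \<and> P Iota \<and> P Pi0 \<and> P Pi1 \<and> P Neg \<and> P Rhd \<and> P Plus"
  by (metis sym.exhaust)

lemma all_args_1: "(\<forall>xs. length xs = Suc 0 \<and> set xs \<subseteq> A \<longrightarrow> P xs) \<longleftrightarrow> (\<forall>x\<in>A. P [x])"
  by (auto simp: length_Suc_conv)

lemma all_args_2:
  "(\<forall>xs. length xs = 2 \<and> set xs \<subseteq> A \<longrightarrow> P xs) \<longleftrightarrow> (\<forall>x\<in>A. \<forall>y\<in>A. P [x, y])"
  by (auto simp: numeral_2_eq_2 length_Suc_conv)

lemma all_args_sym:
  "(\<forall>f xs. length xs = sym_arity f \<and> set xs \<subseteq> A \<longrightarrow> P f xs) \<longleftrightarrow>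
    P Zero [] \<and> (\<forall>x\<in>A. P Iota [x]) \<and> (\<forall>x\<in>A. P Pi0 [x]) \<and> (\<forall>x\<in>A. P Pi1 [x]) \<and>
    (\<forall>x\<in>A. P Neg [x]) \<and> (\<forall>x\<in>A. P Rhd [x]) \<and> (\<forall>x\<in>A. \<forall>y\<in>A. P Plus [x, y])"
  by (simp add: all_sym[of "\<lambda>f. \<forall>xs. length xs = sym_arity f \<and> set xs \<subseteq> A \<longrightarrow> P f xs"]
      all_args_1 all_args_2)

text \<open>The axioms use only the variables 0, 1 and 2, so a valuation matters only through three
  values, and quantifying over functions becomes quantifying over triples.\<close>

lemma all_valuations_3:
  assumes "\<And>v w. v 0 = w 0 \<Longrightarrow> v 1 = w 1 \<Longrightarrow> v 2 = w 2 \<Longrightarrow> P v = P w"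
  shows "(\<forall>v :: nat \<Rightarrow> 'a. range v \<subseteq> A \<longrightarrow> P v) \<longleftrightarrow>
    (\<forall>x\<in>A. \<forall>y\<in>A. \<forall>z\<in>A. P (\<lambda>i. if i = 0 then x else if i = 1 then y else z))"
proof (intro iffI allI ballI impI)
  fix v :: "nat \<Rightarrow> 'a"
  assume all: "\<forall>x\<in>A. \<forall>y\<in>A. \<forall>z\<in>A. P (\<lambda>i. if i = 0 then x else if i = 1 then y else z)"
    and "range v \<subseteq> A"
  then have "P (\<lambda>i. if i = 0 then v 0 else if i = 1 then v 1 else v 2)"
    by blast
  then show "P v"
    \<comment> \<open>The rotation moves the premise about \<open>P\<close> to the front, where the
      chained fact fixes the other valuation; the three agreement conditions are left to
      simp.\<close>
    by (rule iffD1[OF assms, rotated -1]) simp_all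
next
  fix x y z
  assume "\<forall>v. range v \<subseteq> A \<longrightarrow> P v" and "x \<in> A" "y \<in> A" "z \<in> A"
  moreover from this have "range (\<lambda>i::nat. if i = 0 then x else if i = 1 then y else z) \<subseteq> A"
    by auto
  ultimately show "P (\<lambda>i. if i = 0 then x else if i = 1 then y else z)"
    by blast
qed

lemma is_model_iff: "is_model sym_arity axioms_POGrp M \<longleftrightarrow> pog_model M"
proof -
  have valuations: "satisfies M q \<longleftrightarrow> (\<forall>x\<in>carrier M. \<forall>y\<in>carrier M. \<forall>z\<in>carrier M.
      let v = (\<lambda>i. if i = 0 then x else if i = 1 then y else z)
      in (\<forall>e\<in>set (prems q). holds M v e) \<longrightarrow> holds M v (concl q))"
    if "q \<in> axioms_POGrp" for q
    unfolding satisfies_def Let_def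
    by (rule all_valuations_3)
      (use that in \<open>auto simp: axioms_POGrp_def axioms_M_def axioms_P_def axioms_G_def
        axioms_Inj_def axioms_C_def holds_def\<close>)
  show ?thesis
  proof (cases "interp M Zero [] \<in> carrier M")
    case True
    \<comment> \<open>needed to drop the quantifiers over variables not occurring in an axiom\<close>
    then have ne: "\<exists>x. x \<in> carrier M" by blast
    have eq: "(\<forall>q\<in>axioms_POGrp. satisfies M q) \<longleftrightarrow>
      (\<forall>q\<in>axioms_POGrp. \<forall>x\<in>carrier M. \<forall>y\<in>carrier M. \<forall>z\<in>carrier M.
        let v = (\<lambda>i. if i = 0 then x else if i = 1 then y else z)
        in (\<forall>e\<in>set (prems q). holds M v e) \<longrightarrow> holds M v (concl q))"
      by (simp only: valuations cong: ball_cong)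
    show ?thesis
      unfolding is_model_def all_args_sym eq
      unfolding pog_model_def axioms_POGrp_def axioms_M_def axioms_P_def axioms_G_def
        axioms_Inj_def axioms_C_def
      by (simp add: holds_def Let_def ball_Un ne True)
        (unfold Ball_def, intro iffI; elim conjE; intro conjI; assumption)
  next
    \<comment> \<open>Both sides demand closure under the constant, so both fail.\<close>
    case False
    then show ?thesis
      unfolding is_model_def all_args_sym pog_model_def by simp
  qed
qed

lemma model_hom_iff:
  "h \<in> model_hom sym_arity M N \<longleftrightarrow> h \<in> carrier M \<rightarrow>\<^sub>E carrier N \<and>
    h (interp M Zero []) = interp N Zero [] \<and>
    (\<forall>x\<in>carrier M. h (interp M Iota [x]) = interp N Iota [h x]) \<and>
    (\<forall>x\<in>carrier M. h (interp M Pi0 [x]) = interp N Pi0 [h x]) \<and>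
    (\<forall>x\<in>carrier M. h (interp M Pi1 [x]) = interp N Pi1 [h x]) \<and>
    (\<forall>x\<in>carrier M. h (interp M Neg [x]) = interp N Neg [h x]) \<and>
    (\<forall>x\<in>carrier M. h (interp M Rhd [x]) = interp N Rhd [h x]) \<and>
    (\<forall>x\<in>carrier M. \<forall>y\<in>carrier M. h (interp M Plus [x, y]) = interp N Plus [h x, h y])"
  unfolding model_hom_def mem_Collect_eq all_args_sym by simp

lemma Obj_Alg_iff: "M \<in> Obj (Alg sym_arity axioms_POGrp) \<longleftrightarrow> pog_model M"
  by (simp add: Alg_def is_model_iff)

section \<open>From models to preordered groups\<close>

text \<open>The cone must be a subset of the group, so positive parts enter through their images
  under \<open>iota\<close>. The whole carrier may be used because \<open>iota\<close> depends only
  on the positive part.\<close>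

definition pog_of_model :: "('u, sym) alg_struct \<Rightarrow> 'u preord_group" where
  "pog_of_model M =
    \<lparr>carrier = {x \<in> carrier M. interp M Pi1 [x] = interp M Zero []},
     mult = (\<lambda>x y. interp M Plus [x, y]), one = interp M Zero [],
     cone = (\<lambda>x. interp M Iota [x]) ` carrier M\<rparr>"

section \<open>The group and the cone inside a model\<close>

context pog_model
begin

lemma pog_of_model_sel:
  "carrier (pog_of_model M) = {x \<in> carrier M. pi1 x = zero}"
  "x \<otimes>\<^bsub>pog_of_model M\<^esub> y = x \<oplus> y"
  "\<one>\<^bsub>pog_of_model M\<^esub> = zero"
  "cone (pog_of_model M) = iota ` carrier M"
  by (simp_all add: pog_of_model_def)

lemma pi0_eq: "x \<in> carrier M \<Longrightarrow> pi1 x = zero \<Longrightarrow> pi0 x = x"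
  using split01[of x] by simp

lemma pi1_pi1 [simp]: "x \<in> carrier M \<Longrightarrow> pi1 (pi1 x) = pi1 x"
  using split01[of "pi1 x"] by simp

lemma pi0_pi0 [simp]: "x \<in> carrier M \<Longrightarrow> pi0 (pi0 x) = pi0 x"
  by (simp add: pi0_eq)

text \<open>By (P3) the left side is the group component of \<open>iota x\<close>, and
  \<open>iota x\<close> equals that component because its positive part vanishes. Thus
  \<open>iota\<close> forgets the group component of its argument.\<close>

lemma iota_pi1_eq [simp]: "x \<in> carrier M \<Longrightarrow> iota (pi1 x) = iota x"
  by (simp add: iota_pi1 pi0_eq)

lemma iota_eq_zero: "x \<in> carrier M \<Longrightarrow> pi1 x = zero \<Longrightarrow> iota x = zero"
  using iota_pi1_eq[of x] by simp

text \<open>Apply the additive map \<open>pi1\<close> to the equation of (G): the summand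
  \<open>pi1 x\<close> vanishes and the right side is \<open>pi1 x\<close> again.\<close>

lemma pi1_neg: "x \<in> carrier M \<Longrightarrow> pi1 x = zero \<Longrightarrow> pi1 (neg x) = zero"
  using pi1_plus[of x "neg x"] plus_neg[of x] by simp

lemma group_pog_of_model: "group (pog_of_model M)"
proof (rule groupI)
  fix x assume x: "x \<in> carrier (pog_of_model M)"
  then have "neg x \<in> carrier (pog_of_model M)"
    by (simp add: pog_of_model_sel pi1_neg)
  moreover have "neg x \<otimes>\<^bsub>pog_of_model M\<^esub> x = \<one>\<^bsub>pog_of_model M\<^esub>"
    using x by (simp add: pog_of_model_sel neg_plus)
  ultimately show "\<exists>y\<in>carrier (pog_of_model M). y \<otimes>\<^bsub>pog_of_model M\<^esub> x = \<one>\<^bsub>pog_of_model M\<^esub>"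
    by blast
qed (simp_all add: pog_of_model_sel plus_assoc pi1_plus[symmetric])

sublocale grp: group "pog_of_model M"
  by (rule group_pog_of_model)

lemma inv_eq_neg: "x \<in> carrier M \<Longrightarrow> pi1 x = zero \<Longrightarrow> inv\<^bsub>pog_of_model M\<^esub> x = neg x"
  by (rule grp.inv_equality) (simp_all add: pog_of_model_sel neg_plus pi1_neg)

text \<open>By (G), \<open>neg x\<close> is an inverse of \<open>x\<close> only up to
  \<open>pi1 x\<close>; the projection \<open>pi0\<close> kills this defect.\<close>

lemma pi0_neg:
  assumes x: "x \<in> carrier M"
  shows "pi0 (neg x) = inv\<^bsub>pog_of_model M\<^esub> (pi0 x)"
proof -
  have "pi0 (neg x) \<oplus> pi0 x = zero"
    using x by (simp add: pi0_plus neg_plus)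
  then show ?thesis
    using x by (intro grp.inv_equality[symmetric]) (simp_all add: pog_of_model_sel)
qed

text \<open>Applying \<open>iota\<close> to (G) gives
  \<open>iota (neg x) \<oplus> iota x = iota x\<close>. Values of \<open>iota\<close> lie in the
  group, where \<open>iota x\<close> can be cancelled.\<close>

lemma iota_neg:
  assumes x: "x \<in> carrier M"
  shows "iota (neg x) = zero"
proof -
  have "iota (neg x) \<oplus> iota x = iota x"
    using x by (simp add: iota_plus neg_plus)
  then show ?thesis
    using x grp.r_cancel_one[of "iota x" "iota (neg x)"] by (simp add: pog_of_model_sel)
qed

lemma preordered_group_pog_of_model: "preordered_group (pog_of_model M)"
proof (intro preordered_group.intro preordered_group_axioms.intro submonoid.intro)
  fix g p assume g: "g \<in> carrier (pog_of_model M)" and "p \<in> cone (pog_of_model M)"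
  then obtain y where y: "y \<in> carrier M" "p = iota y" and g: "g \<in> carrier M" "pi1 g = zero"
    by (auto simp: pog_of_model_sel)
  \<comment> \<open>The element with group component \<open>g\<close> and positive part
    \<open>pi1 y\<close> is the one at which (C1) exhibits the conjugate of \<open>iota y\<close> by
    \<open>g\<close> as a value of \<open>iota\<close>.\<close>
  have "pi0 (g \<oplus> pi1 y) = g" "pi1 (g \<oplus> pi1 y) = pi1 y"
    using y g by (simp_all add: pi0_plus[symmetric] pi1_plus[symmetric] pi0_eq)
  then have "g \<oplus> p \<oplus> neg g = iota (rhd (g \<oplus> pi1 y))"
    using y g by (simp add: iota_rhd)
  then show "g \<otimes>\<^bsub>pog_of_model M\<^esub> p \<otimes>\<^bsub>pog_of_model M\<^esub> inv\<^bsub>pog_of_model M\<^esub> g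
      \<in> cone (pog_of_model M)"
    using y g by (simp add: pog_of_model_sel inv_eq_neg)
qed (auto simp: pog_of_model_sel iota_plus group_pog_of_model intro: rev_image_eqI[of zero])

end

section \<open>The functor on morphisms\<close>

definition pog_functor ::
  "(('u, sym) alg_struct, 'u \<Rightarrow> 'u, 'u preord_group, 'u \<Rightarrow> 'u) fctr" where
  "pog_functor =
    \<lparr>Fobj = pog_of_model, Fmap = (\<lambda>M N h. restrict h (carrier (pog_of_model M)))\<rparr>"

text \<open>Group and cone are defined through \<open>pi1\<close>, \<open>iota\<close> and the
  constant, with which model morphisms commute; hence restrictions of such morphisms respect
  both.\<close>

lemma cat_functor_pog_functor: "cat_functor (Alg sym_arity axioms_POGrp) POGrp pog_functor"
proof (intro cat_functor.intro cat_functor_axioms.intro category_Alg category_POGrp)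
  fix M :: "('u, sym) alg_struct" assume "M \<in> Obj (Alg sym_arity axioms_POGrp)"
  then interpret M: pog_model M by (simp add: Obj_Alg_iff)
  show "Fobj pog_functor M \<in> Obj POGrp"
    by (simp add: pog_functor_def POGrp_def M.preordered_group_pog_of_model)
  show "Fmap pog_functor M M (Ident (Alg sym_arity axioms_POGrp) M) =
      Ident POGrp (Fobj pog_functor M)"
    by (auto simp: pog_functor_def POGrp_def Alg_def M.pog_of_model_sel fun_eq_iff)
next
  fix M N :: "('u, sym) alg_struct" and h
  assume "M \<in> Obj (Alg sym_arity axioms_POGrp)" "N \<in> Obj (Alg sym_arity axioms_POGrp)"
    and h: "h \<in> Hom (Alg sym_arity axioms_POGrp) M N"
  then interpret M: pog_model M + N: pog_model N by (simp_all add: Obj_Alg_iff)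
  have "h \<in> model_hom sym_arity M N"
    using h by (simp add: Alg_def)
  then show "Fmap pog_functor M N h \<in> Hom POGrp (Fobj pog_functor M) (Fobj pog_functor N)"
    by (auto simp: pog_functor_def POGrp_def pog_of_model_def hom_def model_hom_iff
        M.pi1_plus[symmetric])
next
  fix M N K :: "('u, sym) alg_struct" and h k
  assume "h \<in> Hom (Alg sym_arity axioms_POGrp) M N"
  then show "Fmap pog_functor M K (Comp (Alg sym_arity axioms_POGrp) M N K k h) =
      Comp POGrp (Fobj pog_functor M) (Fobj pog_functor N) (Fobj pog_functor K)
        (Fmap pog_functor N K k) (Fmap pog_functor M N h)"
    by (auto simp: pog_functor_def POGrp_def Alg_def pog_of_model_def model_hom_iff
        compose_def fun_eq_iff)
qed

section \<open>From preordered groups to models\<close>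

text \<open>Models have to live on \<open>'u\<close> itself, so pairs are coded by elements of \<open>'u\<close>.\<close>

locale pair_coding =
  fixes code :: "'u \<times> 'u \<Rightarrow> 'u" and decode :: "'u \<Rightarrow> 'u \<times> 'u"
  assumes decode_code [simp]: "decode (code p) = p"
begin

lemma code_inject [simp]: "code p = code q \<longleftrightarrow> p = q"
  by (metis decode_code)

lemma code_in_image [simp]: "code p \<in> code ` A \<longleftrightarrow> p \<in> A"
  by (auto simp: image_iff)

text \<open>\<open>Neg\<close> inverts the first coordinate and resets the second: negatives of
  positive elements need not be positive, and (G) asks that adding \<open>Neg\<close> leave exactly
  the positive part.\<close>

fun pog_interp :: "'u preord_group \<Rightarrow> sym \<Rightarrow> 'u list \<Rightarrow> 'u" where
  "pog_interp G Zero xs = code (\<one>\<^bsub>G\<^esub>, \<one>\<^bsub>G\<^esub>)"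
| "pog_interp G Iota xs = code (snd (decode (hd xs)), \<one>\<^bsub>G\<^esub>)"
| "pog_interp G Pi0 xs = code (fst (decode (hd xs)), \<one>\<^bsub>G\<^esub>)"
| "pog_interp G Pi1 xs = code (\<one>\<^bsub>G\<^esub>, snd (decode (hd xs)))"
| "pog_interp G Neg xs = code (inv\<^bsub>G\<^esub> (fst (decode (hd xs))), \<one>\<^bsub>G\<^esub>)"
| "pog_interp G Rhd xs =
    (let (g, p) = decode (hd xs) in code (\<one>\<^bsub>G\<^esub>, g \<otimes>\<^bsub>G\<^esub> p \<otimes>\<^bsub>G\<^esub> inv\<^bsub>G\<^esub> g))"
| "pog_interp G Plus xs =
    (let (g, p) = decode (hd xs); (g', p') = decode (xs ! 1)
     in code (g \<otimes>\<^bsub>G\<^esub> g', p \<otimes>\<^bsub>G\<^esub> p'))"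

definition model_of_pog :: "'u preord_group \<Rightarrow> ('u, sym) alg_struct" where
  "model_of_pog G = \<lparr>carrier = code ` (carrier G \<times> cone G), interp = pog_interp G\<rparr>"

lemma model_of_pog_sel [simp]:
  "carrier (model_of_pog G) = code ` (carrier G \<times> cone G)"
  "interp (model_of_pog G) = pog_interp G"
  by (simp_all add: model_of_pog_def)

lemma pog_model_model_of_pog:
  assumes "preordered_group G"
  shows "pog_model (model_of_pog G)"
proof -
  interpret preordered_group G by fact
  have [simp]: "p \<in> cone G \<Longrightarrow> p \<in> carrier G" for p
    using subset by blast
  \<comment> \<open>This is \<open>conj_closed\<close> in the right-nested form that rewriting with
    \<open>m_assoc\<close> produces.\<close>
  have [simp]: "g \<otimes>\<^bsub>G\<^esub> (p \<otimes>\<^bsub>G\<^esub> inv\<^bsub>G\<^esub> g) \<in> cone G"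
    if "g \<in> carrier G" "p \<in> cone G" for g p
    using conj_closed[OF that] that by (simp add: m_assoc)
  show ?thesis
    by unfold_locales (auto simp: m_assoc inv_mult_group)
qed

definition model_functor ::
  "('u preord_group, 'u \<Rightarrow> 'u, ('u, sym) alg_struct, 'u \<Rightarrow> 'u) fctr" where
  "model_functor =
    \<lparr>Fobj = model_of_pog,
     Fmap = (\<lambda>G H f. \<lambda>x\<in>carrier (model_of_pog G). code (map_prod f f (decode x)))\<rparr>"

text \<open>Morphisms act on both coordinates. Monotonicity keeps the second coordinate in the cone,
  and preservation of products and inverses by group homomorphisms yields compatibility with
  \<open>Neg\<close> and \<open>Rhd\<close>.\<close>

lemma cat_functor_model_functor:
  "cat_functor POGrp (Alg sym_arity axioms_POGrp) model_functor"
proof (intro cat_functor.intro cat_functor_axioms.intro category_Alg category_POGrp)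
  fix G :: "'u preord_group" assume G: "G \<in> Obj POGrp"
  then interpret G: preordered_group G by (simp add: POGrp_def)
  show "Fobj model_functor G \<in> Obj (Alg sym_arity axioms_POGrp)"
    by (simp add: model_functor_def Obj_Alg_iff pog_model_model_of_pog G.preordered_group_axioms)
  show "Fmap model_functor G G (Ident POGrp G) =
      Ident (Alg sym_arity axioms_POGrp) (Fobj model_functor G)"
    using G.subset by (auto simp: model_functor_def POGrp_def Alg_def fun_eq_iff)
next
  fix G H :: "'u preord_group" and f
  assume G: "G \<in> Obj POGrp" and H: "H \<in> Obj POGrp" and f: "f \<in> Hom POGrp G H"
  interpret G: preordered_group G using G by (simp add: POGrp_def)
  interpret H: preordered_group H using H by (simp add: POGrp_def)
  interpret group_hom G H f
    using f by unfold_locales (simp add: POGrp_def)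
  have "p \<in> cone G \<Longrightarrow> p \<in> carrier G" and "p \<in> cone G \<Longrightarrow> f p \<in> cone H" for p
    using G.subset f by (auto simp: POGrp_def)
  then show "Fmap model_functor G H f
      \<in> Hom (Alg sym_arity axioms_POGrp) (Fobj model_functor G) (Fobj model_functor H)"
    by (auto simp: model_functor_def Alg_def model_hom_iff G.conj_closed)
next
  fix G H K :: "'u preord_group" and f g
  assume "G \<in> Obj POGrp" and f: "f \<in> Hom POGrp G H"
  then interpret G: preordered_group G by (simp add: POGrp_def)
  have "g \<in> carrier G \<Longrightarrow> f g \<in> carrier H" and "p \<in> cone G \<Longrightarrow> f p \<in> cone H" for g p
    using f by (auto simp: POGrp_def hom_def)
  then show "Fmap model_functor G K (Comp POGrp G H K g f) =
      Comp (Alg sym_arity axioms_POGrp) (Fobj model_functor G) (Fobj model_functor H)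
        (Fobj model_functor K) (Fmap model_functor H K g) (Fmap model_functor G H f)"
    using G.subset
    by (auto simp: model_functor_def POGrp_def Alg_def compose_def fun_eq_iff)
qed

section \<open>Unit and counit\<close>

definition unit :: "('u, sym) alg_struct \<Rightarrow> 'u \<Rightarrow> 'u" where
  "unit M = (\<lambda>x\<in>carrier M. code (interp M Pi0 [x], interp M Iota [x]))"

lemma is_iso_unit:
  assumes "pog_model M"
  shows "is_iso (Alg sym_arity axioms_POGrp) M (model_of_pog (pog_of_model M)) (unit M)"
proof (rule is_iso_Alg)
  interpret pog_model M by fact
  show "M \<in> Obj (Alg sym_arity axioms_POGrp)"
    using assms by (simp add: Obj_Alg_iff)
  show "unit M \<in> Hom (Alg sym_arity axioms_POGrp) M (model_of_pog (pog_of_model M))"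
    \<comment> \<open>\<open>Neg\<close> is handled by \<open>pi0_neg\<close> and
      \<open>iota_neg\<close>; for \<open>Rhd\<close>, (C1) provides the conjugate in the second
      coordinate, with \<open>neg\<close> as the group inverse.\<close>
    by (auto simp: Alg_def model_hom_iff unit_def pog_of_model_sel pi0_neg iota_neg
        pi0_plus[symmetric] iota_plus[symmetric] iota_rhd inv_eq_neg iota_eq_zero
        iota_pi1[symmetric])
  show "bij_betw (unit M) (carrier M) (carrier (model_of_pog (pog_of_model M)))"
    unfolding bij_betw_def
  proof
    show "inj_on (unit M) (carrier M)"
    proof (rule inj_onI)
      fix x y assume "x \<in> carrier M" "y \<in> carrier M" "unit M x = unit M y"
      then show "x = y"
        \<comment> \<open>The first coordinate determines \<open>pi0 x\<close>, the second
          determines \<open>pi1 x\<close> by (Inj), and \<open>x\<close> is the sum of the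
          two.\<close>
        using split01[of x] split01[of y] iota_inj[of x y] by (simp add: unit_def)
    qed
    \<comment> \<open>In this preimage \<open>pi0\<close> kills the summand \<open>pi1 y\<close>,
      while \<open>iota\<close> kills \<open>g\<close> and sends \<open>pi1 y\<close> to
      \<open>iota y\<close>.\<close>
    have surj: "code (g, iota y) = unit M (g \<oplus> pi1 y)"
      if "g \<in> carrier M" "pi1 g = zero" "y \<in> carrier M" for g y
      using that
      by (simp add: unit_def pi0_plus[symmetric] iota_plus[symmetric] pi0_eq iota_eq_zero)
    show "unit M ` carrier M = carrier (model_of_pog (pog_of_model M))"
    proof
      show "unit M ` carrier M \<subseteq> carrier (model_of_pog (pog_of_model M))"
        by (auto simp: pog_of_model_sel unit_def)
      show "carrier (model_of_pog (pog_of_model M)) \<subseteq> unit M ` carrier M"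
      proof
        fix z assume "z \<in> carrier (model_of_pog (pog_of_model M))"
        then obtain g y where "z = code (g, iota y)"
          and "g \<in> carrier M" "pi1 g = zero" "y \<in> carrier M"
          by (auto simp: pog_of_model_sel)
        then show "z \<in> unit M ` carrier M"
          by (simp add: surj)
      qed
    qed
  qed
qed

text \<open>Since \<open>h\<close> commutes with \<open>pi0\<close> and \<open>iota\<close>, both
  composites send \<open>x\<close> to the code of \<open>h (pi0 x)\<close> and
  \<open>h (iota x)\<close>.\<close>

lemma natural_iso_unit:
  "natural_iso (Alg sym_arity axioms_POGrp) (Alg sym_arity axioms_POGrp) id_fctr
    (comp_fctr model_functor pog_functor) unit"
  unfolding natural_iso_def
proof (intro conjI ballI)
  fix M :: "('u, sym) alg_struct" assume "M \<in> Obj (Alg sym_arity axioms_POGrp)"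
  then show "is_iso (Alg sym_arity axioms_POGrp) (Fobj id_fctr M)
      (Fobj (comp_fctr model_functor pog_functor) M) (unit M)"
    by (simp add: id_fctr_def comp_fctr_def model_functor_def pog_functor_def
        Obj_Alg_iff is_iso_unit)
next
  fix M N :: "('u, sym) alg_struct" and h
  assume "M \<in> Obj (Alg sym_arity axioms_POGrp)" and "N \<in> Obj (Alg sym_arity axioms_POGrp)"
    and h: "h \<in> Hom (Alg sym_arity axioms_POGrp) M N"
  then interpret M: pog_model M + N: pog_model N by (simp_all add: Obj_Alg_iff)
  show "Comp (Alg sym_arity axioms_POGrp) (Fobj id_fctr M) (Fobj id_fctr N)
      (Fobj (comp_fctr model_functor pog_functor) N) (unit N) (Fmap id_fctr M N h) =
    Comp (Alg sym_arity axioms_POGrp) (Fobj id_fctr M)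
      (Fobj (comp_fctr model_functor pog_functor) M)
      (Fobj (comp_fctr model_functor pog_functor) N)
      (Fmap (comp_fctr model_functor pog_functor) M N h) (unit M)"
    using h by (auto simp: id_fctr_def comp_fctr_def model_functor_def pog_functor_def
        Alg_def model_hom_iff compose_def fun_eq_iff unit_def M.pog_of_model_sel)
qed

section \<open>The counit\<close>

definition counit :: "'u preord_group \<Rightarrow> 'u \<Rightarrow> 'u" where
  "counit G = (\<lambda>x\<in>carrier (pog_of_model (model_of_pog G)). fst (decode x))"

text \<open>A coded pair has trivial positive part exactly when its second coordinate is the unit,
  which leaves a copy of \<open>G\<close> in the first coordinate.\<close>

lemma carrier_pog_of_model_of_pog:
  assumes "preordered_group G"
  shows "carrier (pog_of_model (model_of_pog G)) = (\<lambda>g. code (g, \<one>\<^bsub>G\<^esub>)) ` carrier G"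
proof -
  interpret preordered_group G by fact
  show ?thesis by (auto simp: pog_of_model_def)
qed

lemma is_iso_counit:
  assumes "preordered_group G"
  shows "is_iso POGrp (pog_of_model (model_of_pog G)) G (counit G)"
proof (rule is_iso_POGrp)
  interpret preordered_group G by fact
  interpret M: pog_model "model_of_pog G"
    by (rule pog_model_model_of_pog) fact
  \<comment> \<open>\<open>Iota\<close> moves the second coordinate to the first and drops the old
    first one; as the group is non-empty, every element of the cone arises.\<close>
  have cone: "cone (pog_of_model (model_of_pog G)) = (\<lambda>p. code (p, \<one>\<^bsub>G\<^esub>)) ` cone G"
    by (force simp: pog_of_model_def)
  have counit: "counit G (code (g, \<one>\<^bsub>G\<^esub>)) = g" if "g \<in> carrier G" for g
    using that by (simp add: counit_def carrier_pog_of_model_of_pog[OF assms])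
  show "pog_of_model (model_of_pog G) \<in> Obj POGrp" "G \<in> Obj POGrp"
    using assms by (simp_all add: POGrp_def M.preordered_group_pog_of_model)
  show image: "counit G ` cone (pog_of_model (model_of_pog G)) = cone G"
    using subset by (force simp: cone image_image counit)
  show "counit G \<in> Hom POGrp (pog_of_model (model_of_pog G)) G"
    by (auto simp: POGrp_def hom_def image carrier_pog_of_model_of_pog[OF assms] counit)
      (auto simp: counit_def pog_of_model_def)
  show "bij_betw (counit G) (carrier (pog_of_model (model_of_pog G))) (carrier G)"
    by (auto simp: bij_betw_def inj_on_def carrier_pog_of_model_of_pog[OF assms] counit
        image_image)
qed

lemma natural_iso_counit:
  "natural_iso POGrp POGrp (comp_fctr pog_functor model_functor) id_fctr counit"
  unfolding natural_iso_def
proof (intro conjI ballI)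
  fix G :: "'u preord_group" assume "G \<in> Obj POGrp"
  then have "preordered_group G"
    by (simp add: POGrp_def)
  then show "is_iso POGrp (Fobj (comp_fctr pog_functor model_functor) G) (Fobj id_fctr G)
      (counit G)"
    by (simp add: id_fctr_def comp_fctr_def model_functor_def pog_functor_def is_iso_counit)
next
  fix G H :: "'u preord_group" and f
  assume "G \<in> Obj POGrp" and "H \<in> Obj POGrp" and f: "f \<in> Hom POGrp G H"
  then have G: "preordered_group G" and H: "preordered_group H"
    by (simp_all add: POGrp_def)
  interpret G: preordered_group G by fact
  interpret H: preordered_group H by fact
  \<comment> \<open>This supplies that \<open>f\<close> preserves the unit, so the coordinatewise
    action of \<open>f\<close> keeps second coordinates trivial and the counit can be evaluated on
    the result.\<close>
  interpret group_hom G H f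
    using f by unfold_locales (simp add: POGrp_def)
  show "Comp POGrp (Fobj (comp_fctr pog_functor model_functor) G)
      (Fobj (comp_fctr pog_functor model_functor) H) (Fobj id_fctr H) (counit H)
      (Fmap (comp_fctr pog_functor model_functor) G H f) =
    Comp POGrp (Fobj (comp_fctr pog_functor model_functor) G) (Fobj id_fctr G) (Fobj id_fctr H)
      (Fmap id_fctr G H f) (counit G)"
    by (auto simp: id_fctr_def comp_fctr_def model_functor_def pog_functor_def POGrp_def
        compose_def fun_eq_iff counit_def carrier_pog_of_model_of_pog[OF G]
        carrier_pog_of_model_of_pog[OF H])
qed

lemma equivalent_categories_Alg_POGrp:
  "equivalent_categories
    (Alg sym_arity axioms_POGrp :: (('u, sym) alg_struct, 'u \<Rightarrow> 'u) cat)
    (POGrp :: ('u preord_group, 'u \<Rightarrow> 'u) cat)"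
  unfolding equivalent_categories_def
  using category_Alg category_POGrp cat_functor_pog_functor cat_functor_model_functor
    natural_iso_unit natural_iso_counit
  by blast

end

theorem mainTheorem2:
  assumes "infinite (UNIV :: 'u set)"
  shows "equivalent_categories
    (Alg sym_arity axioms_POGrp :: (('u, sym) alg_struct, 'u \<Rightarrow> 'u) cat)
    (POGrp :: ('u preord_group, 'u \<Rightarrow> 'u) cat)"
proof -
  \<comment> \<open>An infinite set is equipotent with its square; the injection has a left inverse,
    which serves as the decoder. The equivalence to be shown does not mention the coding, so any
    choice will do.\<close>
  obtain code :: "'u \<times> 'u \<Rightarrow> 'u" where "inj code"
    using card_of_Times_same_infinite[OF assms] by (auto simp: card_of_ordIso[symmetric] bij_betw_def)
  then interpret pair_coding code "inv_into UNIV code"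
    by unfold_locales simp
  show ?thesis
    by (rule equivalent_categories_Alg_POGrp)
qed

end
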